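(* Let $n,m\ge 1$ be integers, $\mathcal{X}$ a set of inputs, $\boldsymbol{I}:\mathcal{X}\to\mathbb{R}^n$ the (known) feature map, and let $W_S=(w_{ij})\in\mathbb{R}^{n\times m}$ and $\boldsymbol{b}_S\in\mathbb{R}^m$ be the weight matrix and bias vector of the last layer of the student network, whose output is $\mathcal{O}_\theta(\boldsymbol{x})=\mathrm{sigmoid}(\boldsymbol{I}(\boldsymbol{x})^TW_S+\boldsymbol{b}_S)$ (applied componentwise). Let $i_0\in\{1,\dots,n\}$, $j_0\in\{1,\dots,m\}$, and let $\boldsymbol{x}\in\mathcal{X}$ be a non-vanishing input for $i_0$, i.e. $I_{i_0}:=I_{i_0}(\boldsymbol{x})\neq 0$. Let $z_{j_0}$ be the correct value of $\mathcal{O}_{\theta,j_0}(\boldsymbol{x})$, and let $\tilde z_{j_0}$ be the value of $\mathcal{O}_{\theta,j_0}(\boldsymbol{x})$ when a SNIFF on the weight $w_{i_0j_0}$ is carried out. Then \[ w_{i_0j_0}=\frac{1}{2I_{i_0}}\ln\left(\frac{\tilde z_{j_0}^{-1}-1}{z_{j_0}^{-1}-1}\right). \]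
   Context: All computations are in exact real arithmetic. The student network consists of a fixed known feature map $\boldsymbol{I}=(I_1,\dots,I_n):\mathcal{X}\to\mathbb{R}^n$ (the first $k-1$ layers of a public teacher network) followed by one fully connected layer with weights $W_S\in\mathbb{R}^{n\times m}$ and biases $\boldsymbol{b}_S\in\mathbb{R}^m$. For an input $\boldsymbol{x}$, put $y_j(\boldsymbol{x})=b_{S,j}+\sum_{i=1}^n I_i(\boldsymbol{x})w_{ij}$ for $j=1,\dots,m$. With sigmoid activation the $j$-th output is $\mathcal{O}_{\theta,j}(\boldsymbol{x})=1/(1+\exp(-y_j(\boldsymbol{x})))$. SNIFF (sign bit flip fault) on the weight $w_{i_0j_0}$: during the execution on $\boldsymbol{x}$, the product $I_{i_0}(\boldsymbol{x})w_{i_0j_0}$ is replaced by $-I_{i_0}(\boldsymbol{x})w_{i_0j_0}$ in the computation of $y_{j_0}$; everything else is unchanged, and the activation is then applied. *)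

theory Defs
  imports "HOL-Analysis.Analysis"
begin

definition sigmoid :: "real \<Rightarrow> real" where
  "sigmoid t = 1 / (1 + exp (- t))"

(* The products are kept as a separate intermediate result of the execution,
   because the sign bit flip acts on a single one of them. *)
definition products :: "real ^ 'n \<Rightarrow> real ^ 'm ^ 'n \<Rightarrow> real ^ 'm ^ 'n" where
  "products v W = (\<chi> i j. v $ i * W $ i $ j)"

definition accumulate :: "real ^ 'm ^ 'n \<Rightarrow> real ^ 'm \<Rightarrow> real ^ 'm" where
  "accumulate P b = (\<chi> j. b $ j + (\<Sum>i\<in>UNIV. P $ i $ j))"

definition activate :: "real ^ 'm \<Rightarrow> real ^ 'm" where
  "activate y = (\<chi> j. sigmoid (y $ j))"

definition student_output ::
  "('x \<Rightarrow> real ^ 'n) \<Rightarrow> real ^ 'm ^ 'n \<Rightarrow> real ^ 'm \<Rightarrow> 'x \<Rightarrow> real ^ 'm" where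
  "student_output I W b x = activate (accumulate (products (I x) W) b)"

definition flip_sign :: "'n \<Rightarrow> 'm \<Rightarrow> real ^ 'm ^ 'n \<Rightarrow> real ^ 'm ^ 'n" where
  "flip_sign i\<^sub>0 j\<^sub>0 P =
     (\<chi> i j. if i = i\<^sub>0 \<and> j = j\<^sub>0 then - (P $ i $ j) else P $ i $ j)"

definition sniff_output ::
  "'n \<Rightarrow> 'm \<Rightarrow> ('x \<Rightarrow> real ^ 'n) \<Rightarrow> real ^ 'm ^ 'n \<Rightarrow> real ^ 'm \<Rightarrow> 'x \<Rightarrow> real ^ 'm"
  where
  "sniff_output i\<^sub>0 j\<^sub>0 I W b x =
     activate (accumulate (flip_sign i\<^sub>0 j\<^sub>0 (products (I x) W)) b)"

lemma student_output_eq: "student_output I W b x = activate (I x v* W + b)"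
  by (simp add: student_output_def accumulate_def products_def vector_matrix_mult_def
      vec_eq_iff activate_def mult.commute add.commute)

end

theory Submission
  imports Defs
begin

lemma inverse_sigmoid_minus_one: "inverse (sigmoid t) - 1 = exp (- t)"
  by (simp add: sigmoid_def)

lemma accumulate_flip_sign:
  "accumulate (flip_sign i\<^sub>0 j\<^sub>0 P) b $ j\<^sub>0 = accumulate P b $ j\<^sub>0 - 2 * P $ i\<^sub>0 $ j\<^sub>0"
proof -
  have "(\<Sum>i\<in>UNIV. flip_sign i\<^sub>0 j\<^sub>0 P $ i $ j\<^sub>0)
      = (\<Sum>i\<in>UNIV. P $ i $ j\<^sub>0 - (if i = i\<^sub>0 then 2 * P $ i $ j\<^sub>0 else 0))"
    by (rule sum.cong) (auto simp: flip_sign_def)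
  also have "\<dots> = (\<Sum>i\<in>UNIV. P $ i $ j\<^sub>0) - 2 * P $ i\<^sub>0 $ j\<^sub>0"
    by (simp add: sum_subtractf)
  finally show ?thesis
    by (simp add: accumulate_def)
qed

theorem theorem4:
  fixes X :: "'x set"
    and I :: "'x \<Rightarrow> real ^ 'n"
    and W :: "real ^ 'm ^ 'n"
    and b :: "real ^ 'm"
    and i\<^sub>0 :: 'n and j\<^sub>0 :: 'm
    and x :: 'x
    and z z' :: real
  assumes "x \<in> X"
    and "I x $ i\<^sub>0 \<noteq> 0"
    and "z = student_output I W b x $ j\<^sub>0"
    and "z' = sniff_output i\<^sub>0 j\<^sub>0 I W b x $ j\<^sub>0"
  shows "W $ i\<^sub>0 $ j\<^sub>0 =
           1 / (2 * I x $ i\<^sub>0) * ln ((inverse z' - 1) / (inverse z - 1))"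
proof -
  define P where "P = products (I x) W"
  define y where "y = accumulate P b $ j\<^sub>0"
  have z: "inverse z - 1 = exp (- y)"
    using assms(3)
    by (simp add: student_output_def activate_def inverse_sigmoid_minus_one P_def y_def)
  have z': "inverse z' - 1 = exp (- (y - 2 * P $ i\<^sub>0 $ j\<^sub>0))"
    using assms(4)
    by (simp only: sniff_output_def activate_def vec_lambda_beta inverse_sigmoid_minus_one
        accumulate_flip_sign P_def y_def)
  have "(inverse z' - 1) / (inverse z - 1) = exp (2 * P $ i\<^sub>0 $ j\<^sub>0)"
    unfolding z z' by (simp flip: exp_diff)
  then show ?thesis
    using assms(2) by (simp add: P_def products_def)
qed

end
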